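(* Let $n\in\{2,3\}$ and consider $n$-player continuous Guts with the Weenie rule, with payoff $\alpha$ to player 1 and stakes multiplier $\beta$. Let $p^*=1/3$ if $n=2$ and $p^*=1/\sqrt3$ if $n=3$ (the symmetric Nash equilibrium thresholds). Then the pure threshold strategy $p_1^*=p^*$ is optimal for player 1 against general (not necessarily bloc) strategies of a coalition of players $2,\dots,n$, and it forces $\underline V=0$. That is: (i) $\alpha(p^*,p_2^*,\dots,p_n^* )\ge0$ for all $(p_2^*,\dots,p_n^* )\in[0,1]^{n-1}$, and $p^*$ is a maximin strategy of player 1, with maximin value $0$, in the one-shot two-player zero-sum game with payoff $\alpha$ of player 1 against the coalition; (ii) starting from $V_0=-1$, the limit of the values forced by repeated play of $p^*$, namely $W_0=-1$, $W_{k+1}=\inf_{q\in[0,1]^{n-1}}\big(\alpha(p^*,q)+\beta(p^*,q)W_k\big)$, equals $0$, and this is the value $\underline V$ forceable by player 1 in the full game of player 1 against the coalition.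
   Context: $n$-player continuous Guts with the Weenie rule: each player $i$ independently receives a hand $p_i$ uniformly distributed on $[0,1]$ (higher is better), and without knowing the other hands decides to hold or drop. A pure strategy for player $i$ is a threshold $p_i^*\in[0,1]$: hold if $p_i>p_i^*$, otherwise drop. At unit stakes each player has an ante of $1$ in a pot of $n$; by convention the ante is charged upon termination. The immediate return of each player and the stakes multiplier for the next round in each event are: - exactly one player holds: the holder gets $n-1$, all others get $-1$, and the multiplier is $0$ (the game terminates); - $r\ge2$ players hold: the holder with highest hand gets $n+(r-2)$, each other holder gets $-n+(r-2)$, each dropping player gets $r-2$, and the multiplier is $r-1$; - no player holds (Weenie rule): the player with highest hand must match the pot and gets $-n+1$, every other player gets $+1$, and the stakes double (multiplier $2$). $\alpha(p_1^*,\dots,p_n^* )$ denotes the expected immediate return to player 1 and $\beta(p_1^*,\dots,p_n^* )$ the expected stakes multiplier when the players use thresholds $p_1^*,\dots,p_n^*$. The players $2,\dots,n$ are treated as a single opponent (synchronous coalition) whose pure strategies are tuples $(p_2^*,\dots,p_n^* )\in[0,1]^{n-1}$ and whose mixed strategies are arbitrary probability distributions on $[0,1]^{n-1}$; mixed strategies of player 1 are probability distributions on $[0,1]$. A bloc strategy is one with $p_2^*=\dots=p_n^*$. The termination fee of player 1 is $1$, i.e. $V_0=-1$; the values forceable by player 1 in $k$ rounds are $V_{k+1}=\sup_x\inf_q\mathbb{E}_{p\sim x}[\alpha(p,q)+\beta(p,q)V_k]$ (supremum over mixed strategies $x$ of player 1, infimum over $q\in[0,1]^{n-1}$), and $\underline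 V=\lim_{k\to\infty}V_k$. *)

theory Defs
  imports "HOL-Probability.Probability"
begin

text \<open>
  Players are \<open>1, \<dots>, n\<close>. A threshold profile \<open>t\<close> and a deal of hands \<open>h\<close> are functions on the
  player indices; only their values on \<open>{1..n}\<close> matter.
\<close>

definition holders :: "nat \<Rightarrow> (nat \<Rightarrow> real) \<Rightarrow> (nat \<Rightarrow> real) \<Rightarrow> nat set" where
  "holders n t h = {i \<in> {1..n}. h i > t i}"

text \<open>Ties count as highest for each of the tied players; they occur with probability 0.\<close>

definition highest :: "nat set \<Rightarrow> (nat \<Rightarrow> real) \<Rightarrow> nat \<Rightarrow> bool" where
  "highest S h i \<longleftrightarrow> i \<in> S \<and> (\<forall>j\<in>S. h j \<le> h i)"

definition guts_return :: "nat \<Rightarrow> (nat \<Rightarrow> real) \<Rightarrow> (nat \<Rightarrow> real) \<Rightarrow> nat \<Rightarrow> real" where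
  "guts_return n t h i =
    (let H = holders n t h; r = card H in
      if r = 0 then (if highest {1..n} h i then - real n + 1 else 1)
      else if r = 1 then (if i \<in> H then real n - 1 else - 1)
      else if i \<notin> H then real r - 2
      else if highest H h i then real n + (real r - 2)
      else - real n + (real r - 2))"

definition guts_mult :: "nat \<Rightarrow> (nat \<Rightarrow> real) \<Rightarrow> (nat \<Rightarrow> real) \<Rightarrow> real" where
  "guts_mult n t h =
    (let r = card (holders n t h) in
      if r = 0 then 2 else if r = 1 then 0 else real r - 1)"

definition deal :: "nat \<Rightarrow> (nat \<Rightarrow> real) measure" where
  "deal n = PiM {1..n} (\<lambda>_. uniform_measure lborel {0..1})"

definition \<alpha> :: "nat \<Rightarrow> (nat \<Rightarrow> real) \<Rightarrow> real" where
  "\<alpha> n t = (\<integral>h. guts_return n t h 1 \<partial>deal n)"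

definition \<beta> :: "nat \<Rightarrow> (nat \<Rightarrow> real) \<Rightarrow> real" where
  "\<beta> n t = (\<integral>h. guts_mult n t h \<partial>deal n)"

text \<open>
  A coalition tuple is an extensional function \<open>q\<close> on \<open>{2..n}\<close>; together with a threshold \<open>p\<close> of
  player 1 it gives the profile \<open>q(1 := p)\<close>.
\<close>

definition coalition_pure :: "nat \<Rightarrow> (nat \<Rightarrow> real) set" where
  "coalition_pure n = {2..n} \<rightarrow>\<^sub>E {0..1}"

definition player_mixed :: "real measure set" where
  "player_mixed = {x. prob_space x \<and> sets x = sets (restrict_space borel {0..1})}"

definition coalition_mixed :: "nat \<Rightarrow> (nat \<Rightarrow> real) measure set" where
  "coalition_mixed n =
    {y. prob_space y \<and> sets y = sets (PiM {2..n} (\<lambda>_. restrict_space borel {0..1}))}"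

definition pure :: "real \<Rightarrow> real measure" where
  "pure p = return (restrict_space borel {0..1}) p"

definition guarantee :: "nat \<Rightarrow> real measure \<Rightarrow> real" where
  "guarantee n x = (INF y \<in> coalition_mixed n. \<integral>p. (\<integral>q. \<alpha> n (q(1 := p)) \<partial>y) \<partial>x)"

definition maximin_value :: "nat \<Rightarrow> real" where
  "maximin_value n = (SUP x \<in> player_mixed. guarantee n x)"

definition maximin_strategy :: "nat \<Rightarrow> real measure \<Rightarrow> bool" where
  "maximin_strategy n x \<longleftrightarrow> x \<in> player_mixed \<and> (\<forall>x' \<in> player_mixed. guarantee n x' \<le> guarantee n x)"

text \<open>Values forceable by player 1 in \<open>k\<close> rounds, starting from the termination fee.\<close>

primrec V :: "nat \<Rightarrow> nat \<Rightarrow> real" where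
  "V n 0 = - 1"
| "V n (Suc k) =
    (SUP x \<in> player_mixed. INF q \<in> coalition_pure n.
      \<integral>p. \<alpha> n (q(1 := p)) + \<beta> n (q(1 := p)) * V n k \<partial>x)"

text \<open>Values forced in \<open>k\<close> rounds by repeated play of the fixed pure threshold \<open>p\<close>.\<close>

primrec W :: "nat \<Rightarrow> real \<Rightarrow> nat \<Rightarrow> real" where
  "W n p 0 = - 1"
| "W n p (Suc k) =
    (INF q \<in> coalition_pure n. \<alpha> n (q(1 := p)) + \<beta> n (q(1 := p)) * W n p k)"

end

theory Submission imports Defs begin

text \<open>
  Conditioning on the hand of player 1 gives closed forms for \<open>\<alpha>\<close> and \<open>\<beta>\<close> on \<open>[0,1]\<^sup>n\<close>. In the
  difference \<open>\<alpha> - \<beta>\<close> only integrals of \<open>\<Prod> max(q\<^sub>j, x)\<close> and \<open>\<Prod> min(q\<^sub>j, x)\<close> depend on the coalition, and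
  comparing these factors with \<open>x\<close> shows that the bloc strategy at player 1's own threshold \<open>p\<close>
  minimises the difference, with value \<open>- c\<close> where \<open>c = n (1 - p) - 1 + 3 p\<^sup>n\<close> is the multiplier there.
  If \<open>\<alpha>(p, \<cdot>) \<ge> 0\<close>, then for \<open>0 \<le> w \<le> 1\<close> the identity
  \<open>\<alpha> - \<beta> w = (1 - w) \<alpha> + w (\<alpha> - \<beta>)\<close> gives \<open>\<alpha> - \<beta> w \<ge> - c w\<close>, with equality at the bloc strategy. Hence
  \<open>W\<^sub>k = - c\<^sup>k\<close> exactly, while \<open>W\<^sub>k \<le> V\<^sub>k \<le> 0\<close> because the bloc strategy at \<open>p\<close> holds player 1 to \<open>\<alpha> \<le> 0\<close>. For
  \<open>n = 2, 3\<close> the signs of the piecewise polynomials \<open>\<alpha>(p, \<cdot>)\<close> and \<open>\<alpha>(\<cdot>, p, \<dots>, p)\<close> are read off from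
  expansions around \<open>p\<close> in which \<open>3 p\<^sup>2 = 1\<close> (for \<open>n = 3\<close>) cancels the linear terms.
\<close>

section \<open>Closed forms of the payoff and the multiplier\<close>

lemma atLeastAtMost_insert_1: "n \<ge> (1::nat) \<Longrightarrow> {1..n} = insert 1 {2..n}"
  by auto

lemma prod_indicator:
  "finite A \<Longrightarrow> (\<Prod>j\<in>A. indicator (B j) (h j)) = (if \<forall>j\<in>A. h j \<in> B j then 1 else 0 :: real)"
  by (induction A rule: finite_induct) auto

lemma sum_holding: "(\<Sum>i\<in>{1..n}. indicator {t i<..} (h i)) = real (card (holders n t h))"
proof -
  have "(\<Sum>i\<in>{1..n}. indicator {t i<..} (h i)) = (\<Sum>i\<in>{1..n}. if t i < h i then 1 else 0 :: real)"
    by (intro sum.cong) auto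
  also have "\<dots> = real (card (holders n t h))"
    unfolding holders_def by (subst sum.inter_filter[symmetric]) auto
  finally show ?thesis .
qed

lemma prod_dropping:
  "(\<Prod>i\<in>{1..n}. indicator {..t i} (h i)) = (if holders n t h = {} then 1 else 0 :: real)"
  by (subst prod_indicator) (auto simp: holders_def not_less)

text \<open>With \<open>r\<close> holders, the return \<open>r - 2\<close>, shifted by
  \<open>n\<close> for a winning and by \<open>- n\<close> for a losing holder, is already right for
  all \<open>r >= 1\<close>: a lone holder gets \<open>- 1 + n\<close>. For \<open>r = 0\<close> the
  base is \<open>- 2\<close>; the term with factor 3 raises it to 1, and the last term charges
  \<open>n\<close> to the highest hand. Each event is a condition on \<open>h 1\<close> times one
  condition per opponent, ready for integration.\<close>

lemma guts_return_first:
  fixes t h :: "nat \<Rightarrow> real"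
  assumes "n \<ge> 1"
  shows "guts_return n t h 1 =
      (\<Sum>i\<in>{1..n}. indicator {t i<..} (h i)) - 2
      + real n * (2 * (indicator {t 1<..} (h 1) * (\<Prod>j\<in>{2..n}. indicator {..max (t j) (h 1)} (h j)))
          - indicator {t 1<..} (h 1))
      + 3 * (\<Prod>i\<in>{1..n}. indicator {..t i} (h i))
      - real n * (indicator {..t 1} (h 1) * (\<Prod>j\<in>{2..n}. indicator {..min (t j) (h 1)} (h j)))"
proof -
  let ?H = "holders n t h"
  have fin: "finite ?H"
    by (auto simp: holders_def)
  have first: "1 \<in> ?H \<longleftrightarrow> h 1 > t 1"
    using assms by (auto simp: holders_def)
  \<comment> \<open>An opponent fails to beat a holding player 1 by dropping or by having no higher
    hand, which together is the single bound \<open>max (t j) (h 1)\<close>. Dropping with no higher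
    hand gives \<open>min\<close> in \<open>lose\<close>.\<close>
  have win: "highest ?H h 1 \<longleftrightarrow> h 1 > t 1 \<and> (\<forall>j\<in>{2..n}. h j \<le> max (t j) (h 1))"
  proof -
    have "highest ?H h 1 \<longleftrightarrow> h 1 > t 1 \<and> (\<forall>j\<in>{1..n}. h j > t j \<longrightarrow> h j \<le> h 1)"
      unfolding highest_def first by (auto simp: holders_def)
    also have "(\<forall>j\<in>{1..n}. h j > t j \<longrightarrow> h j \<le> h 1) \<longleftrightarrow> (\<forall>j\<in>{2..n}. h j \<le> max (t j) (h 1))"
      unfolding atLeastAtMost_insert_1[OF assms] by (auto simp: max_def not_less)
    finally show ?thesis .
  qed
  have lose: "?H = {} \<and> highest {1..n} h 1 \<longleftrightarrow> h 1 \<le> t 1 \<and> (\<forall>j\<in>{2..n}. h j \<le> min (t j) (h 1))"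
  proof -
    have "?H = {} \<and> highest {1..n} h 1 \<longleftrightarrow> (\<forall>j\<in>{1..n}. h j \<le> t j) \<and> (\<forall>j\<in>{1..n}. h j \<le> h 1)"
      using assms by (auto simp: highest_def holders_def not_less)
    then show ?thesis
      unfolding atLeastAtMost_insert_1[OF assms] by auto
  qed
  have A: "indicator {t 1<..} (h 1) * (\<Prod>j\<in>{2..n}. indicator {..max (t j) (h 1)} (h j))
      = (if highest ?H h 1 then 1 else 0 :: real)"
    unfolding prod_indicator[OF finite_atLeastAtMost] win by (auto simp: indicator_def)
  have B: "indicator {..t 1} (h 1) * (\<Prod>j\<in>{2..n}. indicator {..min (t j) (h 1)} (h j))
      = (if ?H = {} \<and> highest {1..n} h 1 then 1 else 0 :: real)"
    unfolding prod_indicator[OF finite_atLeastAtMost] lose by (auto simp: indicator_def)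
  have C: "indicator {t 1<..} (h 1) = (if 1 \<in> ?H then 1 else 0 :: real)"
    unfolding first by simp
  consider "?H = {}" | "?H = {1}" | "card ?H = 1" "1 \<notin> ?H" | "card ?H \<noteq> 0" "card ?H \<noteq> 1"
    using fin by (metis card_0_eq card_1_singletonE singletonD)
  then show ?thesis
  proof cases
    case 1
    then show ?thesis
      unfolding guts_return_def Let_def A B sum_holding prod_dropping unfolding C by (simp add: highest_def)
  next
    case 2
    then show ?thesis
      unfolding guts_return_def Let_def A B sum_holding prod_dropping unfolding C by (simp add: highest_def)
  next
    case 3
    then have "?H \<noteq> {}" "\<not> highest ?H h 1"
      by (auto simp: highest_def)
    with 3 show ?thesis
      unfolding guts_return_def Let_def A B sum_holding prod_dropping unfolding C by simp
  next
    case 4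
    then have "?H \<noteq> {}" "highest ?H h 1 \<Longrightarrow> 1 \<in> ?H"
      by (auto simp: highest_def)
    with 4 show ?thesis
      unfolding guts_return_def Let_def A B sum_holding prod_dropping unfolding C by simp
  qed
qed

text \<open>The value \<open>r - 1\<close> also gives the multiplier 0 at \<open>r = 1\<close>; at
  \<open>r = 0\<close> it is \<open>- 1\<close>, and adding 3 yields the doubling.\<close>

lemma guts_mult_eq:
  "guts_mult n t h =
     (\<Sum>i\<in>{1..n}. indicator {t i<..} (h i)) - 1 + 3 * (\<Prod>i\<in>{1..n}. indicator {..t i} (h i))"
proof -
  let ?H = "holders n t h"
  have fin: "finite ?H"
    by (auto simp: holders_def)
  show ?thesis
    unfolding guts_mult_def Let_def sum_holding prod_dropping using fin by auto
qed

section \<open>Expectations over independent uniform hands\<close>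

abbreviation U :: "real measure" where
  "U \<equiv> uniform_measure lborel {0..1}"

lemma prob_space_U: "prob_space U"
  by (rule prob_space_uniform_measure) auto

interpretation U: product_prob_space "\<lambda>_::nat. U" I for I
  by (rule product_prob_spaceI) (rule prob_space_U)

lemma prob_space_deal: "prob_space (deal n)"
  unfolding deal_def by (rule prob_space_PiM) (rule prob_space_U)

lemma measure_U_atMost: "measure U {..a} = max 0 (min 1 a)"
proof -
  have "{0..1} \<inter> {..a} = {0..min 1 a}"
    by auto
  then show ?thesis
    by (auto simp: max_def)
qed

lemma integral_U:
  fixes f :: "real \<Rightarrow> real"
  assumes [measurable]: "f \<in> borel_measurable borel"
  shows "(\<integral>x. f x \<partial>U) = (LINT x:{0..1}|lborel. f x)"
proof -
  have *: "U = density lborel (\<lambda>x. ennreal (indicator {0..1} x))"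
    by (simp add: uniform_measure_def divide_ennreal_def ennreal_indicator)
  show ?thesis
    unfolding * by (subst integral_density) (auto simp: set_lebesgue_integral_def)
qed

text \<open>Fubini with the hand of player 1 outermost: given \<open>h 1 = x\<close>, the other
  hands are independent and uniform, so factor \<open>j\<close> integrates to the probability
  \<open>m j x\<close>. The bounds may vary with \<open>x\<close>, as the \<open>max\<close> and
  \<open>min\<close> bounds in the return do.\<close>

lemma integral_deal_first:
  fixes g :: "real \<Rightarrow> real" and m :: "nat \<Rightarrow> real \<Rightarrow> real"
  assumes n: "n \<ge> 1"
    and g [measurable]: "g \<in> borel_measurable borel" and gb: "\<And>x. g x \<in> {0..1}"
    and m [measurable]: "\<And>j. m j \<in> borel_measurable borel"
    and mb: "\<And>j x. j \<in> {2..n} \<Longrightarrow> x \<in> {0..1} \<Longrightarrow> m j x \<in> {0..1}"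
  shows "integrable (deal n) (\<lambda>h. g (h 1) * (\<Prod>j\<in>{2..n}. indicator {..m j (h 1)} (h j)))" (is ?I)
    and "(\<integral>h. g (h 1) * (\<Prod>j\<in>{2..n}. indicator {..m j (h 1)} (h j)) \<partial>deal n)
      = (LINT x:{0..1}|lborel. g x * (\<Prod>j\<in>{2..n}. m j x))" (is ?E)
proof -
  interpret D: prob_space "deal n" by (rule prob_space_deal)
  let ?f = "\<lambda>h. g (h 1) * (\<Prod>j\<in>{2..n}. indicator {..m j (h 1)} (h j)) :: real"
  have meas1: "(\<lambda>h. h 1) \<in> PiM {1..n} (\<lambda>_. U) \<rightarrow>\<^sub>M borel"
    using n measurable_component_singleton[of 1 "{1..n}" "\<lambda>_. U"] by (simp add: measurable_def)
  have measj: "(\<lambda>h. h j) \<in> PiM {1..n} (\<lambda>_. U) \<rightarrow>\<^sub>M borel" if "j \<in> {2..n}" for j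
    using n that measurable_component_singleton[of j "{1..n}" "\<lambda>_. U"] by (simp add: measurable_def)
  \<comment> \<open>The set \<open>{..m j (h 1)}\<close> moves with the deal, so measurability is
    reduced to comparing two measurable functions of \<open>h\<close>.\<close>
  have ind: "indicator {..a} b = (if b \<le> a then 1 else 0 :: real)" for a b :: real
    by auto
  have meas: "?f \<in> borel_measurable (deal n)"
    unfolding deal_def ind using meas1 measj
    by (intro borel_measurable_times borel_measurable_prod measurable_If borel_measurable_const
        measurable_compose[OF meas1 g] measurable_compose[OF meas1 m] borel_measurable_pred_less)
      (auto intro!: borel_measurable_le measurable_compose[OF meas1 m] simp: pred_def)
  have "\<bar>?f h\<bar> \<le> 1" for h
    using gb[of "h 1"] by (simp add: prod_indicator)
  then show int: ?I
    by (intro D.integrable_const_bound[where B=1] meas) auto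
  have I: "{1..n} = {1} \<union> {2..n}"
    using n by auto
  let ?F = "\<lambda>z. g z * (\<Prod>j\<in>{2..n}. measure U {..m j z})"
  have "(\<integral>h. ?f h \<partial>deal n) = (\<integral>x. (\<integral>y. ?f (merge {1} {2..n} (x, y)) \<partial>PiM {2..n} (\<lambda>_. U)) \<partial>PiM {1} (\<lambda>_. U))"
    using int unfolding deal_def I by (intro U.product_integral_fold) auto
  also have "\<dots> = (\<integral>x. ?F (x 1) \<partial>PiM {1::nat} (\<lambda>_. U))"
  proof (rule Bochner_Integration.integral_cong[OF refl])
    fix x
    have "(\<integral>y. ?f (merge {1} {2..n} (x, y)) \<partial>PiM {2..n} (\<lambda>_. U))
        = (\<integral>y. g (x 1) * (\<Prod>j\<in>{2..n}. indicator {..m j (x 1)} (y j)) \<partial>PiM {2..n} (\<lambda>_. U))"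
      by (intro Bochner_Integration.integral_cong refl arg_cong2[where f="(*)"] prod.cong)
        (auto simp: merge_def)
    also have "\<dots> = g (x 1) * (\<Prod>j\<in>{2..n}. \<integral>y. indicator {..m j (x 1)} y \<partial>U)"
      by (simp, subst U.product_integral_prod) (auto intro!: U.M.integrable_const_bound[where B=1])
    finally show "(\<integral>y. ?f (merge {1} {2..n} (x, y)) \<partial>PiM {2..n} (\<lambda>_. U)) = ?F (x 1)"
      by simp
  qed
  also have "\<dots> = (\<integral>z. ?F z \<partial>U)"
    by (rule U.product_integral_singleton) (simp add: measure_U_atMost)
  also have "\<dots> = (LINT x:{0..1}|lborel. ?F x)"
    by (rule integral_U) (simp add: measure_U_atMost)
  also have "\<dots> = (LINT x:{0..1}|lborel. g x * (\<Prod>j\<in>{2..n}. m j x))"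
    using mb by (intro set_lebesgue_integral_cong allI impI arg_cong2[where f="(*)"] prod.cong refl)
      (auto simp: measure_U_atMost)
  finally show ?E .
qed

lemma integral_deal_single:
  assumes "i \<in> {1..n}" "a \<in> {0..1}"
  shows "integrable (deal n) (\<lambda>h. indicator {a<..} (h i) :: real)" (is ?I)
    and "(\<integral>h. indicator {a<..} (h i) \<partial>deal n) = 1 - a" (is ?E)
proof -
  have meas [measurable]: "(\<lambda>h. h i) \<in> deal n \<rightarrow>\<^sub>M U"
    using assms(1) unfolding deal_def by (rule measurable_component_singleton)
  have distr: "distr (deal n) U (\<lambda>h. h i) = U"
    unfolding deal_def using assms(1) by (rule U.PiM_component)
  have "(\<integral>h. indicator {a<..} (h i) \<partial>deal n) = (\<integral>x. indicator {a<..} x \<partial>distr (deal n) U (\<lambda>h. h i) :: real)"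
    by (rule integral_distr[symmetric, OF meas]) simp
  also have "\<dots> = measure U (space U - {..a})"
    unfolding distr Compl_atMost[symmetric] by (simp add: Compl_eq_Diff_UNIV)
  also have "\<dots> = 1 - a"
    using assms(2) by (subst U.M.prob_compl) (auto simp: measure_U_atMost)
  finally show ?E .
  have "integrable U (indicator {a<..} :: real \<Rightarrow> real)"
    by (auto intro!: U.M.integrable_const_bound[where B=1])
  then show ?I
    using integrable_distr[OF meas, of "indicator {a<..} :: real \<Rightarrow> real"] unfolding distr by simp
qed

lemma integral_deal_prod:
  assumes "\<And>i. i \<in> {1..n} \<Longrightarrow> t i \<in> {0..1}"
  shows "integrable (deal n) (\<lambda>h. \<Prod>i\<in>{1..n}. indicator {..t i} (h i) :: real)" (is ?I)
    and "(\<integral>h. (\<Prod>i\<in>{1..n}. indicator {..t i} (h i)) \<partial>deal n) = (\<Prod>i\<in>{1..n}. t i)" (is ?E)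
proof -
  have *: "integrable U (indicator {..t i} :: real \<Rightarrow> real)" for i
    by (auto intro!: U.M.integrable_const_bound[where B=1])
  show ?I
    unfolding deal_def by (rule U.product_integrable_prod) (use * in auto)
  have "(\<integral>h. (\<Prod>i\<in>{1..n}. indicator {..t i} (h i)) \<partial>deal n) = (\<Prod>i\<in>{1..n}. measure U {..t i})"
    unfolding deal_def by (subst U.product_integral_prod) (use * in auto)
  also have "\<dots> = (\<Prod>i\<in>{1..n}. t i)"
    using assms by (intro prod.cong) (auto simp: measure_U_atMost)
  finally show ?E .
qed

text \<open>Within the unit interval, \<open>A\<close> and \<open>{a..b}\<close> differ at most in
  the two endpoints, a null set. This turns the half-open event of holding and the closed event of
  dropping into integrals over closed intervals.\<close>

lemma set_integral_Icc_restrict: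
  fixes f :: "real \<Rightarrow> real"
  assumes f: "continuous_on UNIV f" and ab: "{a..b} \<subseteq> {0..1}"
    and A: "A \<in> sets borel" "{a<..<b} \<subseteq> A \<inter> {0..1}" "A \<inter> {0..1} \<subseteq> {a..b}"
  shows "(LINT x:{0..1}|lborel. indicator A x * f x) = integral {a..b} f"
proof -
  have [measurable]: "f \<in> borel_measurable borel"
    using f by (rule borel_measurable_continuous_onI)
  note [measurable] = A(1)
  have "(LINT x:{0..1}|lborel. indicator A x * f x) = (LINT x:{a..b}|lborel. f x)"
    unfolding set_lebesgue_integral_def
  proof (rule integral_cong_AE)
    show "AE x in lborel. indicator {0..1} x *\<^sub>R (indicator A x * f x) = indicator {a..b} x *\<^sub>R f x"
      using AE_lborel_singleton[of a] AE_lborel_singleton[of b]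
    proof eventually_elim
      case (elim x)
      then have "x \<in> {a<..<b} \<longleftrightarrow> x \<in> {a..b}" by auto
      then have "x \<in> A \<inter> {0..1} \<longleftrightarrow> x \<in> {a..b}" using A(2,3) by blast
      then show ?case by (auto simp: indicator_def)
    qed
  qed auto
  also have "\<dots> = integral {a..b} f"
    by (rule set_borel_integral_eq_integral, rule borel_integrable_atLeastAtMost')
      (rule continuous_on_subset[OF f], simp)
  finally show ?thesis .
qed

text \<open>
  The two integrands are the conditional probabilities, given that player 1 has hand \<open>x\<close>, that no
  other holder beats player 1, and that the others all drop with hands below \<open>x\<close>.
\<close>

lemma \<alpha>_eq:
  assumes n: "n \<ge> 1" and t: "\<And>i. i \<in> {1..n} \<Longrightarrow> t i \<in> {0..1}"
  shows "\<alpha> n t = (\<Sum>i\<in>{1..n}. 1 - t i) - 2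
      + real n * (2 * integral {t 1..1} (\<lambda>x. \<Prod>j\<in>{2..n}. max (t j) x) - (1 - t 1))
      + 3 * (\<Prod>i\<in>{1..n}. t i)
      - real n * integral {0..t 1} (\<lambda>x. \<Prod>j\<in>{2..n}. min (t j) x)"
proof -
  interpret D: prob_space "deal n" by (rule prob_space_deal)
  have 1: "1 \<in> {1..n}" and t1: "t 1 \<in> {0..1}"
    using n t[of 1] by auto
  have tj: "j \<in> {2..n} \<Longrightarrow> t j \<in> {0..1}" for j
    using t[of j] by auto
  have cont: "continuous_on UNIV (\<lambda>x. \<Prod>j\<in>{2..n}. max (t j) x)"
    "continuous_on UNIV (\<lambda>x. \<Prod>j\<in>{2..n}. min (t j) x)"
    by (intro continuous_intros)+
  have mx: "max a x \<in> {0..1}" "min a x \<in> {0..1}" if "a \<in> {0..1}" "x \<in> {0..1}" for a x :: real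
    using that by auto
  note win = integral_deal_first[OF n, of "indicator {t 1<..}" "\<lambda>j. max (t j)"]
  note lose = integral_deal_first[OF n, of "indicator {..t 1}" "\<lambda>j. min (t j)"]
  have w: "(LINT x:{0..1}|lborel. indicator {t 1<..} x * (\<Prod>j\<in>{2..n}. max (t j) x))
      = integral {t 1..1} (\<lambda>x. \<Prod>j\<in>{2..n}. max (t j) x)"
    using t1 by (intro set_integral_Icc_restrict cont) auto
  have l: "(LINT x:{0..1}|lborel. indicator {..t 1} x * (\<Prod>j\<in>{2..n}. min (t j) x))
      = integral {0..t 1} (\<lambda>x. \<Prod>j\<in>{2..n}. min (t j) x)"
    using t1 by (intro set_integral_Icc_restrict cont) auto
  have W: "integrable (deal n) (\<lambda>h. indicator {t 1<..} (h 1) * (\<Prod>j\<in>{2..n}. indicator {..max (t j) (h 1)} (h j)) :: real)"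
    "(\<integral>h. indicator {t 1<..} (h 1) * (\<Prod>j\<in>{2..n}. indicator {..max (t j) (h 1)} (h j)) \<partial>deal n)
      = integral {t 1..1} (\<lambda>x. \<Prod>j\<in>{2..n}. max (t j) x)"
    unfolding w[symmetric] by (intro win mx tj; simp add: indicator_def)+
  have L: "integrable (deal n) (\<lambda>h. indicator {..t 1} (h 1) * (\<Prod>j\<in>{2..n}. indicator {..min (t j) (h 1)} (h j)) :: real)"
    "(\<integral>h. indicator {..t 1} (h 1) * (\<Prod>j\<in>{2..n}. indicator {..min (t j) (h 1)} (h j)) \<partial>deal n)
      = integral {0..t 1} (\<lambda>x. \<Prod>j\<in>{2..n}. min (t j) x)"
    unfolding l[symmetric] by (intro lose mx tj; simp add: indicator_def)+
  have S: "integrable (deal n) (\<lambda>h. indicator {t i<..} (h i) :: real)"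
    "(\<integral>h. indicator {t i<..} (h i) \<partial>deal n) = 1 - t i" if "i \<in> {1..n}" for i
    using integral_deal_single[OF that t[OF that]] by auto
  have P: "integrable (deal n) (\<lambda>h. \<Prod>i\<in>{1..n}. indicator {..t i} (h i) :: real)"
    "(\<integral>h. (\<Prod>i\<in>{1..n}. indicator {..t i} (h i)) \<partial>deal n) = (\<Prod>i\<in>{1..n}. t i)"
    using integral_deal_prod[of n t] t by blast+
  have const: "has_bochner_integral (deal n) (\<lambda>_. c) c" for c :: real
    by (simp add: has_bochner_integral_iff D.prob_space)
  show ?thesis
    unfolding \<alpha>_def guts_return_first[OF n]
    by (rule has_bochner_integral_integral_eq, intro has_bochner_integral_add has_bochner_integral_diff
        has_bochner_integral_mult_right has_bochner_integral_sum const)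
      (use W L P S S[OF 1] in \<open>simp_all add: has_bochner_integral_iff del: One_nat_def\<close>)
qed

lemma \<beta>_eq:
  assumes t: "\<And>i. i \<in> {1..n} \<Longrightarrow> t i \<in> {0..1}"
  shows "\<beta> n t = (\<Sum>i\<in>{1..n}. 1 - t i) - 1 + 3 * (\<Prod>i\<in>{1..n}. t i)"
proof -
  interpret D: prob_space "deal n" by (rule prob_space_deal)
  have S: "integrable (deal n) (\<lambda>h. indicator {t i<..} (h i) :: real)"
    "(\<integral>h. indicator {t i<..} (h i) \<partial>deal n) = 1 - t i" if "i \<in> {1..n}" for i
    using integral_deal_single[OF that t[OF that]] by auto
  have P: "integrable (deal n) (\<lambda>h. \<Prod>i\<in>{1..n}. indicator {..t i} (h i) :: real)"
    "(\<integral>h. (\<Prod>i\<in>{1..n}. indicator {..t i} (h i)) \<partial>deal n) = (\<Prod>i\<in>{1..n}. t i)"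
    using integral_deal_prod[of n t] t by blast+
  have const: "has_bochner_integral (deal n) (\<lambda>_. c) c" for c :: real
    by (simp add: has_bochner_integral_iff D.prob_space)
  show ?thesis
    unfolding \<beta>_def guts_mult_eq
    by (rule has_bochner_integral_integral_eq, intro has_bochner_integral_add has_bochner_integral_diff
        has_bochner_integral_mult_right has_bochner_integral_sum const)
      (use P S in \<open>simp_all add: has_bochner_integral_iff del: One_nat_def\<close>)
qed

section \<open>Repeated play against a coalition\<close>

text \<open>Used to bound expected payoffs under mixed strategies, so that the real-valued infima
  over the coalition are taken over sets bounded below.\<close>

lemma abs_integral_prob_space_le:
  fixes f :: "'a \<Rightarrow> real"
  assumes "prob_space M" and f: "\<And>x. \<bar>f x\<bar> \<le> B"
  shows "\<bar>\<integral>x. f x \<partial>M\<bar> \<le> B"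
proof (cases "integrable M f")
  case True
  interpret prob_space M by fact
  have "- B \<le> f x" "f x \<le> B" for x
    using f[of x] by linarith+
  then show ?thesis
    using integral_ge_const[OF True, of "- B"] integral_le_const[OF True, of B] by (simp add: abs_le_iff)
next
  \<comment> \<open>A nonintegrable function has integral 0 by convention, and 0 satisfies the bound
    because \<open>B\<close> dominates an absolute value.\<close>
  case False
  have "0 \<le> B"
    using f[of undefined] by linarith
  then show ?thesis
    using False by (simp add: not_integrable_integral_eq)
qed

text \<open>
  The Bochner integral of a non-measurable function is \<open>0\<close>, so no measurability of \<open>g\<close> is needed in the
  next two lemmas as long as the bound has the right sign.
\<close>

lemma integral_return_ge:
  fixes g :: "'a \<Rightarrow> real"
  assumes "x \<in> space M" "c \<le> g x" "c \<le> 0"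
  shows "c \<le> (\<integral>y. g y \<partial>return M x)"
proof (cases "g \<in> borel_measurable M")
  case True
  then show ?thesis
    using assms by (simp add: integral_return)
next
  case False
  then have "\<not> integrable (return M x) g"
    using borel_measurable_integrable by fastforce
  then show ?thesis
    using assms by (simp add: not_integrable_integral_eq)
qed

lemma integral_return_le:
  fixes g :: "'a \<Rightarrow> real"
  assumes "x \<in> space M" "g x \<le> c" "0 \<le> c"
  shows "(\<integral>y. g y \<partial>return M x) \<le> c"
  using integral_return_ge[of x M "- c" "\<lambda>y. - g y"] assms by simp

lemma integral_nonpos:
  fixes f :: "'a \<Rightarrow> real"
  assumes "\<And>x. x \<in> space M \<Longrightarrow> f x \<le> 0"
  shows "(\<integral>x. f x \<partial>M) \<le> 0"
proof -
  have "0 \<le> (\<integral>x. - f x \<partial>M)"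
    by (rule Bochner_Integration.integral_nonneg) (use assms in auto)
  then show ?thesis by simp
qed

section \<open>Uniform bounds on \<alpha> and \<beta>\<close>

lemma card_holders_le: "card (holders n t h) \<le> n"
proof -
  have "holders n t h \<subseteq> {1..n}"
    by (auto simp: holders_def)
  then show ?thesis
    using card_mono[of "{1..n}" "holders n t h"] by simp
qed

lemma abs_\<alpha>_le: "\<bar>\<alpha> n t\<bar> \<le> 2 * real n + 2"
  unfolding \<alpha>_def
proof (rule abs_integral_prob_space_le[OF prob_space_deal])
  show "\<bar>guts_return n t h 1\<bar> \<le> 2 * real n + 2" for h
    using card_holders_le[of n t h] by (simp add: guts_return_def Let_def abs_le_iff)
qed

lemma abs_\<beta>_le: "\<bar>\<beta> n t\<bar> \<le> real n + 2"
  unfolding \<beta>_def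
proof (rule abs_integral_prob_space_le[OF prob_space_deal])
  show "\<bar>guts_mult n t h\<bar> \<le> real n + 2" for h
    using card_holders_le[of n t h] by (simp add: guts_mult_def Let_def abs_le_iff)
qed

lemma \<beta>_nonneg: "0 \<le> \<beta> n t"
  unfolding \<beta>_def
  by (intro Bochner_Integration.integral_nonneg) (auto simp: guts_mult_def Let_def)

text \<open>Serves integrands with kinks: between two breakpoints the integrand agrees with the
  derivative of a smooth \<open>F\<close>, and the endpoint values do not affect the
  integral.\<close>

lemma has_integral_interior_FTC:
  fixes F f g :: "real \<Rightarrow> real"
  assumes "a \<le> b" "\<And>x. (F has_real_derivative f x) (at x)" "\<And>x. x \<in> {a<..<b} \<Longrightarrow> g x = f x"
  shows "(g has_integral F b - F a) {a..b}"
proof -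
  have "(f has_integral F b - F a) {a..b}"
    using assms(1,2) by (intro fundamental_theorem_of_calculus)
      (auto simp: has_real_derivative_iff_has_vector_derivative[symmetric] intro: DERIV_subset)
  then show ?thesis
    using has_integral_spike_interior[of f _ a b g] assms(3) by simp
qed

section \<open>Comparison of \<alpha> with \<beta>\<close>

lemma coalition_profile:
  assumes "q \<in> coalition_pure n" "p \<in> {0..1}" "i \<in> {1..n}"
  shows "(q(1 := p)) i \<in> {0..1}"
proof (cases "i = 1")
  case False
  with assms have "i \<in> {2..n}" by auto
  with assms False show ?thesis
    by (auto simp: coalition_pure_def dest: PiE_mem)
qed (use assms in auto)

text \<open>The sum of holding probabilities and the product of thresholds cancel in the difference.
  What remains increases with the \<open>max\<close> integral and decreases with the
  \<open>min\<close> integral; factorwise \<open>max (t j) x >= x\<close> and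
  \<open>min (t j) x <= x\<close>. Both comparisons are equalities when every \<open>t j\<close>
  equals \<open>t 1\<close>.\<close>

lemma \<alpha>_minus_\<beta>_ge:
  assumes n: "n \<ge> 1" and t: "\<And>i. i \<in> {1..n} \<Longrightarrow> t i \<in> {0..1}"
  shows "\<alpha> n t - \<beta> n t \<ge> 1 - real n * (1 - t 1) - 3 * t 1 ^ n"
proof -
  let ?p = "t 1"
  have p: "?p \<in> {0..1}"
    using n t by auto
  have pow: "((\<lambda>x. x ^ (n - 1)) has_integral b ^ n / n - a ^ n / n) {a..b}" if "a \<le> b" for a b :: real
    using that n by (intro has_integral_interior_FTC[where F="\<lambda>x. x ^ n / n"])
      (auto intro!: derivative_eq_intros)
  have card: "(\<Prod>j\<in>{2..n}. x) = x ^ (n - 1)" for x :: real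
    by simp
  have "(1 - ?p ^ n) / n \<le> integral {?p..1} (\<lambda>x. \<Prod>j\<in>{2..n}. max (t j) x)"
  proof -
    have "(1 - ?p ^ n) / n = integral {?p..1} (\<lambda>x. \<Prod>j\<in>{2..n}. x)"
      using pow[of ?p 1] p by (simp add: card integral_unique diff_divide_distrib)
    also have "\<dots> \<le> integral {?p..1} (\<lambda>x. \<Prod>j\<in>{2..n}. max (t j) x)"
      using p by (intro integral_le integrable_continuous_interval continuous_intros prod_mono) auto
    finally show ?thesis .
  qed
  moreover have "integral {0..?p} (\<lambda>x. \<Prod>j\<in>{2..n}. min (t j) x) \<le> ?p ^ n / n"
  proof -
    have "integral {0..?p} (\<lambda>x. \<Prod>j\<in>{2..n}. min (t j) x) \<le> integral {0..?p} (\<lambda>x. \<Prod>j\<in>{2..n}. x)"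
      using p t by (intro integral_le integrable_continuous_interval continuous_intros prod_mono) auto
    also have "\<dots> = ?p ^ n / n"
      using pow[of 0 ?p] p n by (simp add: card integral_unique)
    finally show ?thesis .
  qed
  ultimately have "2 * ((1 - ?p ^ n) / n) - ?p ^ n / n
      \<le> 2 * integral {?p..1} (\<lambda>x. \<Prod>j\<in>{2..n}. max (t j) x)
        - integral {0..?p} (\<lambda>x. \<Prod>j\<in>{2..n}. min (t j) x)"
    by linarith
  then have
    "real n * (2 * integral {?p..1} (\<lambda>x. \<Prod>j\<in>{2..n}. max (t j) x)
        - integral {0..?p} (\<lambda>x. \<Prod>j\<in>{2..n}. min (t j) x))
      \<ge> real n * (2 * ((1 - ?p ^ n) / n) - ?p ^ n / n)"
    by (rule mult_left_mono) simp
  also have "real n * (2 * ((1 - ?p ^ n) / n) - ?p ^ n / n) = 2 - 3 * ?p ^ n"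
    using n by (simp add: field_simps)
  finally have "real n * (2 * integral {?p..1} (\<lambda>x. \<Prod>j\<in>{2..n}. max (t j) x)
      - integral {0..?p} (\<lambda>x. \<Prod>j\<in>{2..n}. min (t j) x)) \<ge> 2 - 3 * ?p ^ n" .
  with \<alpha>_eq[OF n, of t, OF t] \<beta>_eq[of n t, OF t] show ?thesis
    by (simp add: algebra_simps del: One_nat_def)
qed

text \<open>Restricted to \<open>{2..n}\<close> because coalition tuples are extensional
  functions.\<close>

definition bloc :: "nat \<Rightarrow> real \<Rightarrow> nat \<Rightarrow> real" where
  "bloc n p = (\<lambda>j\<in>{2..n}. p)"

lemma bloc_coalition_pure: "p \<in> {0..1} \<Longrightarrow> bloc n p \<in> coalition_pure n"
  by (auto simp: bloc_def coalition_pure_def)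

section \<open>Pure strategies as point masses\<close>

lemma return_coalition_mixed:
  assumes "q \<in> coalition_pure n"
  shows "return (PiM {2..n} (\<lambda>_. restrict_space borel {0..1})) q \<in> coalition_mixed n"
  using assms by (auto simp: coalition_mixed_def coalition_pure_def space_PiM space_restrict_space
      intro!: prob_space_return)

lemma space_coalition_mixed: "y \<in> coalition_mixed n \<Longrightarrow> space y = coalition_pure n"
  using sets_eq_imp_space_eq[of y "PiM {2..n} (\<lambda>_. restrict_space borel {0..1})"]
  by (simp add: coalition_mixed_def coalition_pure_def space_PiM space_restrict_space)

lemma space_player_mixed: "x \<in> player_mixed \<Longrightarrow> space x = {0..1}"
  by (auto simp: player_mixed_def space_restrict_space dest: sets_eq_imp_space_eq)

lemma pure_player_mixed: "p \<in> {0..1} \<Longrightarrow> pure p \<in> player_mixed"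
  by (auto simp: player_mixed_def pure_def space_restrict_space intro!: prob_space_return)

section \<open>Consequences of a saddle point\<close>

text \<open>The two inequalities make \<open>p\<close> against the bloc at \<open>p\<close> a saddle
  point of \<alpha> with value 0. The one-shot claims follow from them for every such
  \<open>n\<close>; the limits follow once the multiplier at the saddle point is below 1.\<close>

locale guts_saddle =
  fixes n :: nat and p :: real
  assumes n: "n \<ge> 1" and p: "p \<in> {0..1}"
    and \<alpha>_nonneg: "\<And>q. q \<in> coalition_pure n \<Longrightarrow> 0 \<le> \<alpha> n (q(1 := p))"
    and \<alpha>_bloc_nonpos: "\<And>p'. p' \<in> {0..1} \<Longrightarrow> \<alpha> n ((bloc n p)(1 := p')) \<le> 0"
begin

lemma bloc_pure: "bloc n p \<in> coalition_pure n"
  using p by (rule bloc_coalition_pure)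

lemma \<alpha>_bloc: "\<alpha> n ((bloc n p)(1 := p)) = 0"
  using \<alpha>_nonneg[OF bloc_pure] \<alpha>_bloc_nonpos[OF p] by simp

text \<open>The point mass on the bloc at \<open>p\<close> answers every mixed strategy of player 1
  with a nonpositive payoff. Boundedness below is what lets a single coalition strategy bound the
  infimum from above.\<close>

lemma guarantee_bounds:
  assumes "x \<in> player_mixed"
  shows "bdd_below ((\<lambda>y. \<integral>p. (\<integral>q. \<alpha> n (q(1 := p)) \<partial>y) \<partial>x) ` coalition_mixed n)"
    and "guarantee n x \<le> 0"
proof -
  have "\<bar>\<integral>p. (\<integral>q. \<alpha> n (q(1 := p)) \<partial>y) \<partial>x\<bar> \<le> 2 * real n + 2" if "y \<in> coalition_mixed n" for y
    using assms that
    by (intro abs_integral_prob_space_le abs_\<alpha>_le) (auto simp: player_mixed_def coalition_mixed_def)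
  then show bdd: "bdd_below ((\<lambda>y. \<integral>p. (\<integral>q. \<alpha> n (q(1 := p)) \<partial>y) \<partial>x) ` coalition_mixed n)"
    by (intro bdd_belowI2[where m="- (2 * real n + 2)"]) (meson abs_le_D2 minus_le_iff)
  show "guarantee n x \<le> 0"
    unfolding guarantee_def
  proof (rule cINF_lower2[OF bdd return_coalition_mixed[OF bloc_pure]])
    show "(\<integral>p'. (\<integral>q. \<alpha> n (q(1 := p')) \<partial>return (PiM {2..n} (\<lambda>_. restrict_space borel {0..1})) (bloc n p)) \<partial>x) \<le> 0"
      using bloc_pure \<alpha>_bloc_nonpos
      by (intro integral_nonpos integral_return_le)
        (auto simp: space_player_mixed[OF assms] coalition_pure_def space_PiM space_restrict_space)
  qed
qed

lemma guarantee_pure: "guarantee n (pure p) = 0"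
proof (rule antisym)
  show "guarantee n (pure p) \<le> 0"
    by (intro guarantee_bounds pure_player_mixed p)
  show "0 \<le> guarantee n (pure p)"
    unfolding guarantee_def
  proof (rule cINF_greatest)
    show "coalition_mixed n \<noteq> {}"
      using return_coalition_mixed[OF bloc_pure] by blast
    show "0 \<le> (\<integral>p. (\<integral>q. \<alpha> n (q(1 := p)) \<partial>y) \<partial>pure p)" if "y \<in> coalition_mixed n" for y
      unfolding pure_def using p \<alpha>_nonneg
      by (intro integral_return_ge Bochner_Integration.integral_nonneg)
        (auto simp: space_restrict_space space_coalition_mixed[OF that])
  qed
qed

lemma maximin_strategy_pure: "maximin_strategy n (pure p)"
  unfolding maximin_strategy_def using pure_player_mixed[OF p] guarantee_bounds(2) guarantee_pure by simp

lemma maximin_value: "maximin_value n = 0"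
  unfolding maximin_value_def
  by (rule cSup_eq_maximum) (use pure_player_mixed[OF p] guarantee_bounds(2) guarantee_pure in force)+

definition c :: real where
  "c = real n * (1 - p) - 1 + 3 * p ^ n"

lemma \<beta>_bloc: "\<beta> n ((bloc n p)(1 := p)) = c"
proof -
  let ?t = "(bloc n p)(1 := p)"
  have *: "?t i = p" if "i \<in> {1..n}" for i
    using that by (auto simp: bloc_def)
  have "\<beta> n ?t = (\<Sum>i\<in>{1..n}. 1 - ?t i) - 1 + 3 * (\<Prod>i\<in>{1..n}. ?t i)"
    by (rule \<beta>_eq) (use * p in metis)
  also have "(\<Sum>i\<in>{1..n}. 1 - ?t i) = (\<Sum>i\<in>{1..n}. 1 - p)"
    by (intro sum.cong refl) (simp only: *)
  also have "(\<Prod>i\<in>{1..n}. ?t i) = (\<Prod>i\<in>{1..n}. p)"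
    by (intro prod.cong refl) (simp only: *)
  finally show ?thesis
    by (simp add: c_def del: fun_upd_apply)
qed

lemma c_nonneg: "0 \<le> c"
  using \<beta>_nonneg by (simp add: \<beta>_bloc[symmetric])

text \<open>Here \<open>- w\<close> is the continuation value. The payoff is a combination of
  \<alpha> and \<alpha> - \<beta> with weights \<open>1 - w\<close> and \<open>w\<close>, both
  nonnegative on the unit interval.\<close>

lemma payoff_ge:
  assumes "q \<in> coalition_pure n" "w \<in> {0..1}"
  shows "- (c * w) \<le> \<alpha> n (q(1 := p)) + \<beta> n (q(1 := p)) * - w"
proof -
  have "\<alpha> n (q(1 := p)) - \<beta> n (q(1 := p)) \<ge> - c"
    using \<alpha>_minus_\<beta>_ge[OF n, of "q(1 := p)"] coalition_profile[OF assms(1) p] by (simp add: c_def)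
  then have "w * (\<alpha> n (q(1 := p)) - \<beta> n (q(1 := p))) \<ge> w * - c"
    using assms(2) by (intro mult_left_mono) auto
  moreover have "(1 - w) * \<alpha> n (q(1 := p)) \<ge> 0"
    using assms \<alpha>_nonneg by (intro mult_nonneg_nonneg) auto
  ultimately show ?thesis
    by (simp add: algebra_simps)
qed

text \<open>The condition \<open>c < 1\<close> acts twice: it keeps \<open>c ^ k\<close> in the
  range of weights covered by \<open>payoff_ge\<close>, and it sends \<open>c ^ k\<close> to
  0.\<close>

context
  assumes c_less_1: "c < 1"
begin

lemma power_c: "c ^ k \<in> {0..1}"
  using c_nonneg c_less_1 by (auto simp: power_le_one)

lemma W_eq: "W n p k = - (c ^ k)"
proof (induction k)
  case (Suc k)
  show ?case
    unfolding W.simps Suc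
  proof (rule cInf_eq_minimum)
    show "- (c ^ Suc k) \<in> (\<lambda>q. \<alpha> n (q(1 := p)) + \<beta> n (q(1 := p)) * - (c ^ k)) ` coalition_pure n"
      by (rule rev_image_eqI[OF bloc_pure]) (simp add: \<alpha>_bloc \<beta>_bloc del: One_nat_def)
  qed (use payoff_ge[OF _ power_c] in auto)
qed simp

text \<open>Below, \<open>pure p\<close> is one candidate in the supremum, and the payoff is
  monotone in the continuation value because \<beta> is nonnegative. Above, the coalition's bloc
  strategy makes both \<alpha> and \<beta> times \<open>V n k\<close> nonpositive.\<close>

lemma V_bounds: "W n p k \<le> V n k \<and> V n k \<le> 0"
proof (induction k)
  case (Suc k)
  let ?f = "\<lambda>x q. \<integral>p. \<alpha> n (q(1 := p)) + \<beta> n (q(1 := p)) * V n k \<partial>x"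
  have le: "(INF q \<in> coalition_pure n. ?f x q) \<le> 0" if x: "x \<in> player_mixed" for x
  proof (rule cINF_lower2[OF _ bloc_pure])
    let ?B = "2 * real n + 2 + (real n + 2) * \<bar>V n k\<bar>"
    have "\<bar>\<alpha> n t + \<beta> n t * V n k\<bar> \<le> ?B" for t
      using abs_\<alpha>_le[of n t] mult_right_mono[OF abs_\<beta>_le[of n t] abs_ge_zero[of "V n k"]]
      by (simp add: abs_mult[symmetric])
    then have "\<bar>?f x q\<bar> \<le> ?B" for q
      using x by (intro abs_integral_prob_space_le) (auto simp: player_mixed_def)
    then show "bdd_below (?f x ` coalition_pure n)"
      by (intro bdd_belowI2[where m="- ?B"]) (meson abs_le_D2 minus_le_iff)
    show "?f x (bloc n p) \<le> 0"
      using Suc \<alpha>_bloc_nonpos \<beta>_nonneg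
      by (intro integral_nonpos add_nonpos_nonpos mult_nonneg_nonpos) (auto simp: space_player_mixed[OF x])
  qed
  have ge: "W n p (Suc k) \<le> (INF q \<in> coalition_pure n. ?f (pure p) q)"
  proof (rule cINF_greatest)
    fix q assume q: "q \<in> coalition_pure n"
    have "- (c * c ^ k) \<le> \<alpha> n (q(1 := p)) + \<beta> n (q(1 := p)) * - (c ^ k)"
      by (rule payoff_ge[OF q power_c])
    also have "\<dots> \<le> \<alpha> n (q(1 := p)) + \<beta> n (q(1 := p)) * V n k"
      using Suc \<beta>_nonneg by (intro add_left_mono mult_left_mono) (auto simp: W_eq)
    \<comment> \<open>\<open>integral_return_ge\<close> asks for a nonpositive lower bound;
      \<open>W_eq\<close> shows that the bound is minus a power of the nonnegative
      \<open>c\<close>.\<close>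
    finally show "W n p (Suc k) \<le> ?f (pure p) q"
      unfolding pure_def W_eq using p c_nonneg
      by (intro integral_return_ge) (auto simp: space_restrict_space)
  qed (use bloc_pure in auto)
  have bdd: "bdd_above ((\<lambda>x. INF q \<in> coalition_pure n. ?f x q) ` player_mixed)"
    by (rule bdd_aboveI2[OF le])
  show ?case
  proof
    show "W n p (Suc k) \<le> V n (Suc k)"
      unfolding V.simps by (rule cSUP_upper2[OF bdd pure_player_mixed[OF p] ge])
    show "V n (Suc k) \<le> 0"
      unfolding V.simps by (rule cSUP_least) (use pure_player_mixed[OF p] le in blast)+
  qed
qed simp

lemma W_tendsto: "W n p \<longlonglongrightarrow> 0"
  unfolding W_eq[abs_def] using c_nonneg c_less_1 tendsto_minus[OF LIMSEQ_power_zero[of c]] by simp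

lemma V_tendsto: "V n \<longlonglongrightarrow> 0"
  by (rule tendsto_sandwich[OF _ _ W_tendsto tendsto_const]) (auto simp: V_bounds)

end

end

section \<open>Two and three players\<close>

text \<open>
  In the next four lemmas \<open>max p q\<close>, \<open>min p r\<close> etc. clamp the breakpoints to the interval of
  integration, so that one formula covers all relative positions of \<open>p\<close>, \<open>q\<close>, \<open>r\<close>.
\<close>

lemma integral_max_2:
  fixes p q :: real
  assumes "p \<le> 1" "q \<le> 1"
  shows "integral {p..1} (\<lambda>x. max q x) = q * (max p q - p) + (1 - (max p q)^2) / 2"
proof -
  let ?f = "\<lambda>x. max q x"
  have "(?f has_integral q * max p q - q * p) {p..max p q}"
    by (rule has_integral_interior_FTC[where F="\<lambda>x. q * x" and f="\<lambda>_. q"]) (auto intro!: derivative_eq_intros)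
  moreover have "(?f has_integral 1^2 / 2 - (max p q)^2 / 2) {max p q..1}"
    by (rule has_integral_interior_FTC[where F="\<lambda>x. x^2 / 2"]) (use assms in \<open>auto intro!: derivative_eq_intros\<close>)
  ultimately have "(?f has_integral (q * max p q - q * p) + (1^2 / 2 - (max p q)^2 / 2)) {p..1}"
    by (rule has_integral_combine[rotated 2]) (use assms in auto)
  then show ?thesis
    by (simp add: integral_unique algebra_simps diff_divide_distrib)
qed

lemma integral_min_2:
  fixes p q :: real
  assumes "0 \<le> p" "0 \<le> q"
  shows "integral {0..p} (\<lambda>x. min q x) = (min p q)^2 / 2 + q * (p - min p q)"
proof -
  let ?f = "\<lambda>x. min q x"
  have "(?f has_integral (min p q)^2 / 2 - 0^2 / 2) {0..min p q}"
    by (rule has_integral_interior_FTC[where F="\<lambda>x. x^2 / 2"]) (use assms in \<open>auto intro!: derivative_eq_intros\<close>)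
  moreover have "(?f has_integral q * p - q * min p q) {min p q..p}"
    by (rule has_integral_interior_FTC[where F="\<lambda>x. q * x" and f="\<lambda>_. q"]) (auto intro!: derivative_eq_intros)
  ultimately have "(?f has_integral ((min p q)^2 / 2 - 0^2 / 2) + (q * p - q * min p q)) {0..p}"
    by (rule has_integral_combine[rotated 2]) (use assms in auto)
  then show ?thesis
    by (simp add: integral_unique algebra_simps)
qed

lemma integral_max_3:
  fixes p q r :: real
  assumes "p \<le> 1" "q \<le> r" "r \<le> 1"
  shows "integral {p..1} (\<lambda>x. max q x * max r x)
    = q * r * (max p q - p) + r * ((max p r)^2 - (max p q)^2) / 2 + (1 - (max p r)^3) / 3"
proof -
  let ?f = "\<lambda>x. max q x * max r x"
  have "(?f has_integral q * r * max p q - q * r * p) {p..max p q}"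
    by (rule has_integral_interior_FTC[where F="\<lambda>x. q * r * x" and f="\<lambda>_. q * r"]) (use assms in \<open>auto intro!: derivative_eq_intros\<close>)
  moreover have "(?f has_integral r * (max p r)^2 / 2 - r * (max p q)^2 / 2) {max p q..max p r}"
    by (rule has_integral_interior_FTC[where F="\<lambda>x. r * x^2 / 2" and f="\<lambda>x. r * x"]) (use assms in \<open>auto intro!: derivative_eq_intros\<close>)
  ultimately have "(?f has_integral (q * r * max p q - q * r * p)
      + (r * (max p r)^2 / 2 - r * (max p q)^2 / 2)) {p..max p r}"
    by (rule has_integral_combine[rotated 2]) (use assms in auto)
  moreover have "(?f has_integral 1^3 / 3 - (max p r)^3 / 3) {max p r..1}"
    by (rule has_integral_interior_FTC[where F="\<lambda>x. x^3 / 3"])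
      (use assms in \<open>auto intro!: derivative_eq_intros simp: power2_eq_square\<close>)
  ultimately have "(?f has_integral (q * r * max p q - q * r * p)
      + (r * (max p r)^2 / 2 - r * (max p q)^2 / 2) + (1^3 / 3 - (max p r)^3 / 3)) {p..1}"
    by (rule has_integral_combine[rotated 2]) (use assms in auto)
  then show ?thesis
    by (simp add: integral_unique algebra_simps diff_divide_distrib)
qed

lemma integral_min_3:
  fixes p q r :: real
  assumes "0 \<le> p" "0 \<le> q" "q \<le> r"
  shows "integral {0..p} (\<lambda>x. min q x * min r x)
    = (min p q)^3 / 3 + q * ((min p r)^2 - (min p q)^2) / 2 + q * r * (p - min p r)"
proof -
  let ?f = "\<lambda>x. min q x * min r x"
  have "(?f has_integral (min p q)^3 / 3 - 0^3 / 3) {0..min p q}"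
    by (rule has_integral_interior_FTC[where F="\<lambda>x. x^3 / 3"])
      (use assms in \<open>auto intro!: derivative_eq_intros simp: power2_eq_square\<close>)
  moreover have "(?f has_integral q * (min p r)^2 / 2 - q * (min p q)^2 / 2) {min p q..min p r}"
    by (rule has_integral_interior_FTC[where F="\<lambda>x. q * x^2 / 2" and f="\<lambda>x. q * x"]) (use assms in \<open>auto intro!: derivative_eq_intros\<close>)
  ultimately have "(?f has_integral ((min p q)^3 / 3 - 0^3 / 3)
      + (q * (min p r)^2 / 2 - q * (min p q)^2 / 2)) {0..min p r}"
    by (rule has_integral_combine[rotated 2]) (use assms in auto)
  moreover have "(?f has_integral q * r * p - q * r * min p r) {min p r..p}"
    by (rule has_integral_interior_FTC[where F="\<lambda>x. q * r * x" and f="\<lambda>_. q * r"]) (use assms in \<open>auto intro!: derivative_eq_intros\<close>)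
  ultimately have "(?f has_integral ((min p q)^3 / 3 - 0^3 / 3)
      + (q * (min p r)^2 / 2 - q * (min p q)^2 / 2) + (q * r * p - q * r * min p r)) {0..p}"
    by (rule has_integral_combine[rotated 2]) (use assms in auto)
  then show ?thesis
    by (simp add: integral_unique algebra_simps diff_divide_distrib)
qed

text \<open>Both orders of the thresholds share the factor \<open>t 2 - t 1\<close>. If one
  threshold is 1/3, the second factor vanishes together with the first, so squares of fixed sign
  appear.\<close>

lemma \<alpha>_2:
  assumes "t 1 \<in> {0..1}" "t 2 \<in> {0..1}"
  shows "\<alpha> 2 t = (t 2 - t 1) * (2 * max (t 1) (t 2) + min (t 1) (t 2) - 1)"
proof -
  have *: "{1..2::nat} = {1, 2}"
    by auto
  have t: "t i \<in> {0..1}" if "i \<in> {1..2}" for i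
    using that assms unfolding * by auto
  have "\<alpha> 2 t = (1 - t 1) + (1 - t 2) - 2
      + 2 * (2 * integral {t 1..1} (\<lambda>x. max (t 2) x) - (1 - t 1)) + 3 * (t 1 * t 2)
      - 2 * integral {0..t 1} (\<lambda>x. min (t 2) x)"
    by (subst \<alpha>_eq[OF _ t]) (simp_all add: * del: One_nat_def)
  then show ?thesis
    using assms by (simp add: integral_max_2 integral_min_2 del: One_nat_def)
      (simp add: max_def min_def field_simps power2_eq_square del: One_nat_def)
qed

section \<open>The sign of \<alpha> for three players\<close>

lemma \<alpha>_3:
  assumes "t 1 \<in> {0..1}" "t 2 \<in> {0..1}" "t 3 \<in> {0..1}"
  shows "\<alpha> 3 t = 2 * t 1 - t 2 - t 3 - 2
      + 6 * integral {t 1..1} (\<lambda>x. max (t 2) x * max (t 3) x) + 3 * (t 1 * t 2 * t 3)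
      - 3 * integral {0..t 1} (\<lambda>x. min (t 2) x * min (t 3) x)"
proof -
  have *: "{1..3::nat} = {1, 2, 3}" "{2..3::nat} = {2, 3}"
    by auto
  have t: "t i \<in> {0..1}" if "i \<in> {1..3}" for i
    using that assms unfolding * by auto
  show ?thesis
    by (subst \<alpha>_eq[OF _ t]) (simp_all add: * del: One_nat_def)
qed

text \<open>The two opponents are interchangeable, which reduces the sign analysis to ordered
  thresholds, as the integral formulas presuppose.\<close>

lemma \<alpha>_3_swap:
  assumes "t 1 \<in> {0..1}" "t 2 \<in> {0..1}" "t 3 \<in> {0..1}" "t' 1 = t 1" "t' 2 = t 3" "t' 3 = t 2"
  shows "\<alpha> 3 t' = \<alpha> 3 t"
  using assms by (simp add: \<alpha>_3 mult_ac del: One_nat_def)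

text \<open>For each position of \<open>s\<close> relative to \<open>q <= r\<close>, \<alpha> is
  expanded in the distances between neighbouring thresholds or from \<open>s\<close>, and regrouped
  into visibly nonnegative terms.\<close>

lemma \<alpha>_3_nonneg:
  fixes t :: "nat \<Rightarrow> real"
  assumes t: "t 2 \<in> {0..1}" "t 3 \<in> {0..1}" and s: "t 1 = 1 / sqrt 3" and le: "t 2 \<le> t 3"
  shows "0 \<le> \<alpha> 3 t"
proof -
  define s q r where "s = t 1" and "q = t 2" and "r = t 3"
  have s3: "3 * s * s = 1" and s0: "0 \<le> s"
    unfolding s_def s by auto
  have s1: "s \<le> 1"
    unfolding s_def s by simp
  have qr: "0 \<le> q" "q \<le> r" "r \<le> 1"
    using t le by (auto simp: q_def r_def)
  have eq: "\<alpha> 3 t = 2 * s - q - r - 2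
      + 6 * (q * r * (max s q - s) + r * ((max s r)^2 - (max s q)^2) / 2 + (1 - (max s r)^3) / 3)
      + 3 * (s * q * r)
      - 3 * ((min s q)^3 / 3 + q * ((min s r)^2 - (min s q)^2) / 2 + q * r * (s - min s r))"
    using \<alpha>_3[of t] t s0 s1 qr by (simp add: integral_max_3 integral_min_3 del: One_nat_def flip: s_def q_def r_def)
  consider "s \<le> q" | "q \<le> s" "s \<le> r" | "r \<le> s"
    by linarith
  then show ?thesis
  proof cases
    case 1
    define u v where "u = q - s" and "v = r - q"
    have uv: "0 \<le> u" "0 \<le> v" and q: "q = s + u" and r: "r = s + u + v"
      using 1 qr by (auto simp: u_def v_def)
    have "\<alpha> 3 t = 3 * u * (s * (2 * u + v) + u * (u + v)) + 3 * s * (u + v)^2 + (u + v)^3"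
      using eq s3 uv unfolding q r by (simp add: max_def min_def) algebra
    also have "\<dots> \<ge> 0"
      using uv s0 by simp
    finally show ?thesis .
  next
    case 2
    define u v where "u = s - q" and "v = r - s"
    have uv: "0 \<le> u" "0 \<le> v" "u \<le> s" and q: "q = s - u" and r: "r = s + v"
      using 2 qr by (auto simp: u_def v_def)
    \<comment> \<open>The expansion is
      \<open>3 * s * (u^2 - 2 * u * v + 2 * v^2) - u^3 + 2 * v^3\<close>. One third of
      \<open>3 * s * u^2\<close> absorbs \<open>- u^3\<close> since \<open>u <= s\<close>; the rest
      completes the square with the negative cross term.\<close>
    have "2 * \<alpha> 3 t = (s - u) * u^2 + 2 * s * (u - 3 / 2 * v)^2 + 3 / 2 * s * v^2 + 2 * v^3"
      using eq s3 uv unfolding q r by (simp add: max_def min_def) algebra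
    moreover have "\<dots> \<ge> 0"
      using uv s0 by simp
    ultimately show ?thesis by linarith
  next
    case 3
    define u w where "u = s - q" and "w = s - r"
    have uw: "0 \<le> w" "w \<le> u" "u \<le> s" and q: "q = s - u" and r: "r = s - w"
      using 3 qr by (auto simp: u_def w_def)
    have clamp: "max s q = s" "max s r = s" "min s q = q" "min s r = r"
      using 3 qr by auto
    \<comment> \<open>The expansion is \<open>3 * s * (u + w)^2 - u^3 - 3 * u * w^2\<close>.
      Replacing \<open>s\<close> by \<open>s - u\<close>, which is \<open>q\<close>, frees
      \<open>3 * u * (u + w)^2\<close> to pay for the negative cubes.\<close>
    have "2 * \<alpha> 3 t = 3 * (s - u) * (u + w)^2 + 2 * u^3 + 6 * u^2 * w"
      using eq s3 unfolding clamp unfolding q r by simp algebra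
    moreover have "\<dots> \<ge> 0"
      using uw s0 by simp
    ultimately show ?thesis by linarith
  qed
qed

text \<open>Against the bloc at \<open>s\<close>, each branch is a cubic in \<open>p\<close> with a
  double root at \<open>s\<close> and the nonnegative cofactor \<open>2 * s + p\<close>; the
  branches differ only by a factor 2.\<close>

lemma \<alpha>_3_nonpos:
  fixes t :: "nat \<Rightarrow> real"
  assumes t: "t 1 \<in> {0..1}" and s: "t 2 = 1 / sqrt 3" "t 3 = 1 / sqrt 3"
  shows "\<alpha> 3 t \<le> 0"
proof -
  define p s where "p = t 1" and "s = 1 / sqrt 3"
  have s3: "3 * s * s = 1" and s0: "0 \<le> s"
    by (auto simp: s_def)
  have s1: "s \<le> 1"
    by (simp add: s_def)
  have p: "0 \<le> p" "p \<le> 1"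
    using t by (auto simp: p_def)
  have eq: "\<alpha> 3 t = 2 * p - s - s - 2
      + 6 * (s * s * (max p s - p) + (1 - (max p s)^3) / 3)
      + 3 * (p * s * s) - 3 * ((min p s)^3 / 3 + s * s * (p - min p s))"
    using \<alpha>_3[of t] t s0 s1 p unfolding s
    by (simp add: integral_max_3 integral_min_3 del: One_nat_def flip: s_def p_def)
  show ?thesis
  proof (cases "p \<le> s")
    case True
    have "\<alpha> 3 t = - ((s - p)^2 * (2 * s + p))"
      using eq s3 True by (simp add: max_def min_def) algebra
    also have "\<dots> \<le> 0"
      using s0 p by simp
    finally show ?thesis .
  next
    case False
    have "\<alpha> 3 t = - (2 * (s - p)^2 * (2 * s + p))"
      using eq s3 False by (simp add: max_def min_def) algebra
    also have "\<dots> \<le> 0"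
      using s0 p by simp
    finally show ?thesis .
  qed
qed

section \<open>The saddle conditions and the multiplier for two and three players\<close>

theorem corollaryB4:
  fixes n :: nat and pstar :: real
  assumes "n \<in> {2, 3}"
    and "pstar = (if n = 2 then 1 / 3 else 1 / sqrt 3)"
  shows "(\<forall>q \<in> coalition_pure n. \<alpha> n (q(1 := pstar)) \<ge> 0)
    \<and> maximin_strategy n (pure pstar)
    \<and> guarantee n (pure pstar) = 0
    \<and> maximin_value n = 0
    \<and> W n pstar \<longlonglongrightarrow> 0
    \<and> V n \<longlonglongrightarrow> 0"
proof -
  have sqrt3: "1 / sqrt 3 \<in> {0..1::real}"
    by simp
  have "guts_saddle n pstar"
  proof
    show "n \<ge> 1" "pstar \<in> {0..1}"
      using assms sqrt3 by auto
  next
    fix q assume q: "q \<in> coalition_pure n"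
    consider "n = 2" "q 2 \<in> {0..1}" | "n = 3" "q 2 \<in> {0..1}" "q 3 \<in> {0..1}"
      using assms(1) q PiE_mem[of q "{2..n}" "\<lambda>_. {0..1}" 2] PiE_mem[of q "{2..n}" "\<lambda>_. {0..1}" 3]
      unfolding coalition_pure_def by auto
    then show "0 \<le> \<alpha> n (q(1 := pstar))"
    proof cases
      case 1
      have "\<alpha> 2 (q(1 := 1 / 3)) = (q 2 - 1 / 3) * (2 * max (1 / 3) (q 2) + min (1 / 3) (q 2) - 1)"
        using 1 by (subst \<alpha>_2) auto
      also have "\<dots> = (if q 2 \<ge> 1 / 3 then 2 * (q 2 - 1 / 3)^2 else (q 2 - 1 / 3)^2)"
        by (simp add: max_def min_def power2_eq_square algebra_simps)
      also have "\<dots> \<ge> 0"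
        by simp
      finally show ?thesis
        using 1 by (simp only: assms(2) if_True simp_thms)
    next
      case 2
      let ?t = "q(1 := 1 / sqrt 3)"
      let ?t' = "?t(2 := q 3, 3 := q 2)"
      have "\<alpha> 3 ?t' = \<alpha> 3 ?t"
        using 2 sqrt3 by (intro \<alpha>_3_swap) auto
      moreover have "0 \<le> \<alpha> 3 ?t" if "q 2 \<le> q 3"
        using 2 that by (intro \<alpha>_3_nonneg) auto
      moreover have "0 \<le> \<alpha> 3 ?t'" if "q 3 \<le> q 2"
        using 2 that by (intro \<alpha>_3_nonneg) auto
      ultimately show ?thesis
        using 2 assms(2) by (cases "q 2 \<le> q 3") auto
    qed
  next
    fix p :: real assume p: "p \<in> {0..1}"
    consider "n = 2" | "n = 3"
      using assms(1) by auto
    then show "\<alpha> n ((bloc n pstar)(1 := p)) \<le> 0"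
    proof cases
      case 1
      have "\<alpha> 2 ((bloc 2 (1 / 3))(1 := p)) = (1 / 3 - p) * (2 * max p (1 / 3) + min p (1 / 3) - 1)"
        using p by (subst \<alpha>_2) (auto simp: bloc_def)
      also have "\<dots> = (if p \<le> 1 / 3 then - ((p - 1 / 3)^2) else - (2 * (p - 1 / 3)^2))"
        by (simp add: max_def min_def power2_eq_square algebra_simps)
      also have "\<dots> \<le> 0"
        by simp
      finally show ?thesis
        using 1 by (simp only: assms(2) if_True simp_thms)
    next
      case 2
      then show ?thesis
        using p assms(2) by (auto intro!: \<alpha>_3_nonpos simp: bloc_def)
    qed
  qed
  then interpret guts_saddle n pstar .
  \<comment> \<open>For two players \<open>c = 2 / 3\<close>. For three,
    \<open>pstar ^ 3 = pstar / 3\<close> turns \<open>c\<close> into \<open>2 - 2 * pstar\<close>,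
    which is below 1 because \<open>pstar > 1 / 2\<close>.\<close>
  have "c < 1"
  proof (cases "n = 2")
    case True
    then show ?thesis
      unfolding c_def using assms(2) by (simp add: power2_eq_square)
  next
    case False
    then have "n = 3" and s: "pstar = 1 / sqrt 3"
      using assms by auto
    moreover have "pstar ^ 3 = pstar / 3"
      by (simp add: s power3_eq_cube)
    moreover have "1 / 2 < pstar"
    proof -
      have "sqrt 3 < sqrt 4"
        by (simp only: real_sqrt_less_iff)
      then show ?thesis
        by (simp add: s field_simps)
    qed
    ultimately show ?thesis
      unfolding c_def by simp
  qed
  then show ?thesis
    using \<alpha>_nonneg maximin_strategy_pure guarantee_pure maximin_value
      W_tendsto[OF \<open>c < 1\<close>] V_tendsto[OF \<open>c < 1\<close>] by blast
qed

end
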